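(* Consider either nearest-neighbor bond percolation on $\mathbb Z^d$ with $d$ sufficiently large, or a percolation model satisfying Assumptions A, B and C with the spread-out parameter $L$ sufficiently large and $d>3(2\wedge\alpha)$. Let $A,K_\alpha\in(0,\infty)$ be the constants (depending on $D$) such that $\hat\tau^{p_c}_n(f_\alpha(n)k)\to A\exp(-K_\alpha|k|^{2\wedge\alpha})$ as $n\to\infty$, uniformly in $k$ on compact subsets of $\mathbb R^d$. Then, as $n\to\infty$, $$\sum_{x\in\mathbb Z^d}\tau^{p_c}_n(x)=A(1+o(1)).$$
   Context: Model. Let $D:\mathbb Z^d\times\mathbb Z^d\to[0,1]$ with $\sum_{v}D(u,v)=1$ for all $u$. For $p\ge0$ with $pD(u,v)\le1$ for all $u,v$, each bond $\{u,v\}$ is independently occupied with probability $pD(u,v)$ and vacant otherwise; the law is $\mathbb P_p$. Write $x\leftrightarrow y$ if $x=y$ or there is a path of occupied bonds from $x$ to $y$; $\mathcal C(x)=\{y:x\leftrightarrow y\}$; $p_c=\inf\{p:\mathbb P_p(|\mathcal C(0)|=\infty)>0\}$. $|\cdot|$ is the Euclidean norm and $\hat f(k)=\sum_{x\in\mathbb Z^d}e^{ik\cdot x}f(x)$. Nearest-neighbor percolation: $D(u,v)=\frac1{2d}$ if $|u-v|=1$ and $0$ otherwise. Assumption A. $D(x,y)$ depends only on $y-x$ (write $D(x)=D(0,x)$) and is invariant under permutations and sign changes of coordinates. Moreover $D(x)=h(x/L)/\sum_{y\in\mathbb Z^d}h(y/L)$, where $L\in(0,\infty)$ is the spread-out parameter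 and $h\ge0$ is bounded and piecewise continuous on $\mathbb R^d$, has the same symmetries, satisfies $\int h=1$, and is either (i) supported in $[-1,1]^d$, or (ii) exponentially decaying ($h(x)\le Ce^{-\kappa\|x\|_\infty}$ for some $C,\kappa>0$), or (iii) there are $\alpha,c_1,c_2>0$, $Q<\infty$ with $c_1|x|^{-d-\alpha}\le h(x)\le c_2|x|^{-d-\alpha}$ for $|x|\ge Q$. Cases (i),(ii) are called finite-range and one sets $\alpha=\infty$; case (iii) is long-range. Here $2\wedge\alpha=\min\{2,\alpha\}$ (and $\alpha=\infty$, $L=1$ for nearest-neighbor). Assumption B. There are $c_1,c_2>0$ with $1-\hat D(k)\ge c_1L^{2\wedge\alpha}|k|^{2\wedge\alpha}$ if $\|k\|_\infty\le L^{-1}$ and $1-\hat D(k)>c_2$ if $\|k\|_\infty\ge L^{-1}$ ($k\in[-\pi,\pi)^d$); and there is $w$ with $0<w=O(L^{2\wedge\alpha})$ such that for $\varepsilon>0$ small, $1-\hat D(k)\le w|k|^{2\wedge\alpha}$ if $|k|\le\varepsilon$. Assumption C. There is $v_\alpha\in(0,\infty)$ such that as $k\to0$, $1-\hat D(k)\sim v_\alpha|k|^{2\wedge\alpha}$ if $\alpha\ne2$, and $1-\hat D(k)\sim v_2|k|^2\log(1/|k|)$ if $\alpha=2$. Scaling. $f_\alpha(n)=(v_\alpha n)^{-1/(2\wedge\alpha)}$ if $\alpha\ne2$ and $f_2(n)=(v_2n\log n)^{-1/2}$. Two-point function. $\tau^p_n(x)=\mathbb P_p(0\leftrightarrow x\text{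 with exactly }n\text{ occupied pivotal bonds})$, where a bond is pivotal for $\{0\leftrightarrow x\}$ if changing only its status changes the occurrence of $\{0\leftrightarrow x\}$. The existence of the constants $A,K_\alpha$ as in the claim is known (it is a separate theorem in the same setting). *)

theory Defs
  imports "HOL-Probability.Probability" "HOL-Library.Landau_Symbols"
    "HOL-Combinatorics.Permutations"
begin

text \<open>The dimension d varies inside the theorem, so R^d is the library's
  Euclidean_space d, whose points are the functions on the naturals that vanish from index d on.
  The lattice Z^d is encoded in the same way.\<close>

abbreviation Rd :: "nat \<Rightarrow> (nat \<Rightarrow> real) set" where
  "Rd d \<equiv> topspace (Euclidean_space d)"

definition Zd :: "nat \<Rightarrow> (nat \<Rightarrow> int) set" where
  "Zd d = {x. \<forall>i\<ge>d. x i = 0}"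

abbreviation origin :: "nat \<Rightarrow> int" where
  "origin \<equiv> \<lambda>_. 0"

abbreviation enorm :: "nat \<Rightarrow> (nat \<Rightarrow> real) \<Rightarrow> real" where
  "enorm d x \<equiv> L2_set x {..<d}"

text \<open>Inserting 0 only makes the maximum meaningful for d = 0.\<close>

definition sup_norm :: "nat \<Rightarrow> (nat \<Rightarrow> real) \<Rightarrow> real" where
  "sup_norm d x = Max (insert 0 ((\<lambda>i. \<bar>x i\<bar>) ` {..<d}))"

definition fourier :: "nat \<Rightarrow> ((nat \<Rightarrow> int) \<Rightarrow> real) \<Rightarrow> (nat \<Rightarrow> real) \<Rightarrow> complex" where
  "fourier d f k = (\<Sum>\<^sub>\<infinity>x\<in>Zd d. cis (\<Sum>i<d. k i * real_of_int (x i)) * complex_of_real (f x))"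


subsection \<open>Percolation\<close>

definition step_kernel :: "nat \<Rightarrow> ((nat \<Rightarrow> int) \<Rightarrow> (nat \<Rightarrow> int) \<Rightarrow> real) \<Rightarrow> bool" where
  "step_kernel d D \<longleftrightarrow>
     (\<forall>u\<in>Zd d. \<forall>v\<in>Zd d. 0 \<le> D u v \<and> D u v \<le> 1) \<and>
     (\<forall>u\<in>Zd d. (D u has_sum 1) (Zd d))"

text \<open>The degenerate bonds \<open>{u} = {u, u}\<close>, which occur when \<open>D u u\<close> is positive, influence
  neither connectivity nor pivotality.\<close>

definition bonds :: "nat \<Rightarrow> (nat \<Rightarrow> int) set set" where
  "bonds d = {{u, v} |u v. u \<in> Zd d \<and> v \<in> Zd d}"

text \<open>Well defined when D is symmetric in its two arguments, as it is in all models below.\<close>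

definition bond_weight :: "((nat \<Rightarrow> int) \<Rightarrow> (nat \<Rightarrow> int) \<Rightarrow> real) \<Rightarrow> (nat \<Rightarrow> int) set \<Rightarrow> real" where
  "bond_weight D b = (THE r. \<exists>u v. b = {u, v} \<and> r = D u v)"

definition perc_law ::
  "nat \<Rightarrow> ((nat \<Rightarrow> int) \<Rightarrow> (nat \<Rightarrow> int) \<Rightarrow> real) \<Rightarrow> real \<Rightarrow> ((nat \<Rightarrow> int) set \<Rightarrow> bool) measure" where
  "perc_law d D p = (\<Pi>\<^sub>M b\<in>bonds d. measure_pmf (bernoulli_pmf (p * bond_weight D b)))"

definition connected_in ::
  "nat \<Rightarrow> ((nat \<Rightarrow> int) set \<Rightarrow> bool) \<Rightarrow> (nat \<Rightarrow> int) \<Rightarrow> (nat \<Rightarrow> int) \<Rightarrow> bool" where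
  "connected_in d \<omega> x y \<longleftrightarrow> (x, y) \<in> {(u, v). {u, v} \<in> bonds d \<and> \<omega> {u, v}}\<^sup>*"

definition cluster ::
  "nat \<Rightarrow> ((nat \<Rightarrow> int) set \<Rightarrow> bool) \<Rightarrow> (nat \<Rightarrow> int) \<Rightarrow> (nat \<Rightarrow> int) set" where
  "cluster d \<omega> x = {y \<in> Zd d. connected_in d \<omega> x y}"

definition admissible_p :: "nat \<Rightarrow> ((nat \<Rightarrow> int) \<Rightarrow> (nat \<Rightarrow> int) \<Rightarrow> real) \<Rightarrow> real \<Rightarrow> bool" where
  "admissible_p d D p \<longleftrightarrow> 0 \<le> p \<and> (\<forall>u\<in>Zd d. \<forall>v\<in>Zd d. p * D u v \<le> 1)"

definition p_crit :: "nat \<Rightarrow> ((nat \<Rightarrow> int) \<Rightarrow> (nat \<Rightarrow> int) \<Rightarrow> real) \<Rightarrow> real" where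
  "p_crit d D = Inf {p. admissible_p d D p \<and>
     measure (perc_law d D p)
       {\<omega> \<in> space (perc_law d D p). infinite (cluster d \<omega> origin)} > 0}"

definition pivotal ::
  "nat \<Rightarrow> ((nat \<Rightarrow> int) set \<Rightarrow> bool) \<Rightarrow> (nat \<Rightarrow> int) \<Rightarrow> (nat \<Rightarrow> int) \<Rightarrow> (nat \<Rightarrow> int) set \<Rightarrow> bool" where
  "pivotal d \<omega> x y b \<longleftrightarrow> b \<in> bonds d \<and>
     connected_in d (fun_upd \<omega> b (\<not> \<omega> b)) x y \<noteq> connected_in d \<omega> x y"

definition two_point ::
  "nat \<Rightarrow> ((nat \<Rightarrow> int) \<Rightarrow> (nat \<Rightarrow> int) \<Rightarrow> real) \<Rightarrow> real \<Rightarrow> nat \<Rightarrow> (nat \<Rightarrow> int) \<Rightarrow> real" where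
  "two_point d D p n x = measure (perc_law d D p)
     {\<omega> \<in> space (perc_law d D p). connected_in d \<omega> origin x \<and>
        finite {b. \<omega> b \<and> pivotal d \<omega> origin x b} \<and>
        card {b. \<omega> b \<and> pivotal d \<omega> origin x b} = n}"


subsection \<open>The models\<close>

definition nn_kernel :: "nat \<Rightarrow> (nat \<Rightarrow> int) \<Rightarrow> (nat \<Rightarrow> int) \<Rightarrow> real" where
  "nn_kernel d u v =
     (if enorm d (\<lambda>i. real_of_int (u i - v i)) = 1 then 1 / (2 * real d) else 0)"

text \<open>The exponent \<open>2 \<and> \<alpha>\<close>, where \<open>\<alpha> = \<infinity>\<close> for finite-range models.\<close>

definition two_min :: "ereal \<Rightarrow> real" where
  "two_min \<alpha> = real_of_ereal (min 2 \<alpha>)"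

text \<open>Lebesgue measure lives on the library's product space of extensional functions, so points
  are carried over to Euclidean_space d by replacing the dummy coordinates with 0.\<close>

definition lebesgue_prod :: "nat \<Rightarrow> (nat \<Rightarrow> real) measure" where
  "lebesgue_prod d = completion (\<Pi>\<^sub>M i\<in>{..<d}. lborel)"

definition zero_ext :: "nat \<Rightarrow> (nat \<Rightarrow> real) \<Rightarrow> nat \<Rightarrow> real" where
  "zero_ext d x = (\<lambda>i. if i < d then x i else 0)"

text \<open>Piecewise continuity on R^d: the space splits into a locally finite disjoint family of
  pieces with Lebesgue-null boundaries, and on the interior of each piece the function agrees with
  one that is continuous up to the boundary. Values on the boundaries are unrestricted.\<close>

definition piecewise_continuous :: "nat \<Rightarrow> ((nat \<Rightarrow> real) \<Rightarrow> real) \<Rightarrow> bool" where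
  "piecewise_continuous d h \<longleftrightarrow>
     (\<exists>\<P>. \<Union>\<P> = Rd d \<and> disjoint \<P> \<and> locally_finite_in (Euclidean_space d) \<P> \<and>
       (\<forall>S\<in>\<P>.
          {x \<in> space (lebesgue_prod d). zero_ext d x \<in> Euclidean_space d frontier_of S}
            \<in> null_sets (lebesgue_prod d) \<and>
          (\<exists>g. continuous_map
                 (subtopology (Euclidean_space d) (Euclidean_space d closure_of S))
                 euclideanreal g \<and>
               (\<forall>x \<in> Euclidean_space d interior_of S. h x = g x))))"

text \<open>In case (iii) the threshold Q may be taken positive, since it can always be enlarged; this
  keeps the negative power away from the origin.\<close>

definition decay_class :: "nat \<Rightarrow> ereal \<Rightarrow> ((nat \<Rightarrow> real) \<Rightarrow> real) \<Rightarrow> bool" where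
  "decay_class d \<alpha> h \<longleftrightarrow>
     \<alpha> = \<infinity> \<and> (\<forall>x\<in>Rd d. h x \<noteq> 0 \<longrightarrow> (\<forall>i<d. x i \<in> {-1..1})) \<or>
     \<alpha> = \<infinity> \<and> (\<exists>C>0. \<exists>\<kappa>>0. \<forall>x\<in>Rd d. h x \<le> C * exp (- \<kappa> * sup_norm d x)) \<or>
     (\<exists>a c1 c2 Q. \<alpha> = ereal a \<and> a > 0 \<and> c1 > 0 \<and> c2 > 0 \<and> Q > 0 \<and>
        (\<forall>x\<in>Rd d. enorm d x \<ge> Q \<longrightarrow>
           c1 * enorm d x powr (- real d - a) \<le> h x \<and>
           h x \<le> c2 * enorm d x powr (- real d - a)))"

definition assumption_A ::
  "nat \<Rightarrow> ereal \<Rightarrow> ((nat \<Rightarrow> real) \<Rightarrow> real) \<Rightarrow> real \<Rightarrow>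
    ((nat \<Rightarrow> int) \<Rightarrow> (nat \<Rightarrow> int) \<Rightarrow> real) \<Rightarrow> bool" where
  "assumption_A d \<alpha> h L D \<longleftrightarrow>
     (\<forall>u\<in>Zd d. \<forall>v\<in>Zd d. D u v = D origin (\<lambda>i. v i - u i)) \<and>
     (\<forall>\<pi>. \<pi> permutes {..<d} \<longrightarrow> (\<forall>x\<in>Zd d. D origin (x \<circ> \<pi>) = D origin x)) \<and>
     (\<forall>s. range s \<subseteq> {-1, 1} \<longrightarrow> (\<forall>x\<in>Zd d. D origin (\<lambda>i. s i * x i) = D origin x)) \<and>
     L > 0 \<and>
     (\<forall>x\<in>Zd d. D origin x = h (\<lambda>i. real_of_int (x i) / L) /
        (\<Sum>\<^sub>\<infinity>y\<in>Zd d. h (\<lambda>i. real_of_int (y i) / L))) \<and>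
     (\<forall>x\<in>Rd d. h x \<ge> 0) \<and>
     (\<exists>M. \<forall>x\<in>Rd d. h x \<le> M) \<and>
     piecewise_continuous d h \<and>
     (\<forall>\<pi>. \<pi> permutes {..<d} \<longrightarrow> (\<forall>x\<in>Rd d. h (x \<circ> \<pi>) = h x)) \<and>
     (\<forall>s. range s \<subseteq> {-1, 1} \<longrightarrow> (\<forall>x\<in>Rd d. h (\<lambda>i. s i * x i) = h x)) \<and>
     has_bochner_integral (lebesgue_prod d) (\<lambda>x. h (zero_ext d x)) 1 \<and>
     decay_class d \<alpha> h"

text \<open>The transform of D is real by symmetry, so taking real parts loses nothing.\<close>

definition D_hat ::
  "nat \<Rightarrow> ((nat \<Rightarrow> int) \<Rightarrow> (nat \<Rightarrow> int) \<Rightarrow> real) \<Rightarrow> (nat \<Rightarrow> real) \<Rightarrow> real" where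
  "D_hat d D k = Re (fourier d (D origin) k)"

text \<open>The constants \<open>c1\<close>, \<open>c2\<close> and \<open>c3\<close> are uniform in L; \<open>c3\<close> is the implied constant in
  \<open>w = O(L^(2 \<and> \<alpha>))\<close>. They are parameters so that the threshold for L can depend on them.\<close>

definition assumption_B ::
  "nat \<Rightarrow> ereal \<Rightarrow> real \<Rightarrow> real \<Rightarrow> real \<Rightarrow> real \<Rightarrow>
    ((nat \<Rightarrow> int) \<Rightarrow> (nat \<Rightarrow> int) \<Rightarrow> real) \<Rightarrow> bool" where
  "assumption_B d \<alpha> c1 c2 c3 L D \<longleftrightarrow>
     (\<forall>k\<in>Rd d. (\<forall>i<d. - pi \<le> k i \<and> k i < pi) \<longrightarrow>
        (sup_norm d k \<le> 1 / L \<longrightarrow>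
           1 - D_hat d D k \<ge> c1 * L powr two_min \<alpha> * enorm d k powr two_min \<alpha>) \<and>
        (sup_norm d k \<ge> 1 / L \<longrightarrow> 1 - D_hat d D k > c2)) \<and>
     (\<exists>w. 0 < w \<and> w \<le> c3 * L powr two_min \<alpha> \<and>
        (\<exists>\<epsilon>>0. \<forall>k\<in>Rd d. enorm d k \<le> \<epsilon> \<longrightarrow>
           1 - D_hat d D k \<le> w * enorm d k powr two_min \<alpha>))"

text \<open>The product topology on functions restricts to the Euclidean topology on \<open>Rd d\<close>.\<close>

definition assumption_C ::
  "nat \<Rightarrow> ereal \<Rightarrow> real \<Rightarrow> ((nat \<Rightarrow> int) \<Rightarrow> (nat \<Rightarrow> int) \<Rightarrow> real) \<Rightarrow> bool" where
  "assumption_C d \<alpha> v D \<longleftrightarrow> v > 0 \<and>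
     (\<lambda>k. 1 - D_hat d D k) \<sim>[at (\<lambda>_. 0) within Rd d]
       (\<lambda>k. if \<alpha> = 2 then v * (enorm d k)\<^sup>2 * ln (1 / enorm d k)
            else v * enorm d k powr two_min \<alpha>)"

definition scale :: "ereal \<Rightarrow> real \<Rightarrow> nat \<Rightarrow> real" where
  "scale \<alpha> v n =
     (if \<alpha> = 2 then (v * real n * ln (real n)) powr (- 1 / 2)
      else (v * real n) powr (- 1 / two_min \<alpha>))"

definition tau_scaling_limit ::
  "nat \<Rightarrow> ereal \<Rightarrow> real \<Rightarrow> ((nat \<Rightarrow> int) \<Rightarrow> (nat \<Rightarrow> int) \<Rightarrow> real) \<Rightarrow> real \<Rightarrow> real \<Rightarrow> bool" where
  "tau_scaling_limit d \<alpha> v D A K \<longleftrightarrow>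
     (\<forall>S. compactin (Euclidean_space d) S \<longrightarrow>
        uniform_limit S
          (\<lambda>n k. fourier d (two_point d D (p_crit d D) n) (\<lambda>i. scale \<alpha> v n * k i))
          (\<lambda>k. complex_of_real (A * exp (- K * enorm d k powr two_min \<alpha>)))
          sequentially)"

text \<open>Stated with \<open>has_sum\<close> so that convergence of the series is part of the claim.\<close>

definition tau_sum_asymptotics ::
  "nat \<Rightarrow> ((nat \<Rightarrow> int) \<Rightarrow> (nat \<Rightarrow> int) \<Rightarrow> real) \<Rightarrow> real \<Rightarrow> bool" where
  "tau_sum_asymptotics d D A \<longleftrightarrow>
     (\<exists>e :: nat \<Rightarrow> real. e \<in> o(\<lambda>_. 1) \<and>
        (\<forall>\<^sub>F n in sequentially.
           (two_point d D (p_crit d D) n has_sum (A * (1 + e n))) (Zd d)))"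

end

theory Submission
  imports Defs
begin

text \<open>At \<open>k = 0\<close> the Fourier transform is the sum of \<open>\<tau>\<^sub>n\<close>, so only the scaling limit at the
  single frequency \<open>0\<close> is needed. Convergence of the series comes for free: a divergent
  \<open>\<Sum>\<^sub>\<infinity>\<close> has the junk value \<open>0\<close>, which is excluded for large \<open>n\<close> because the limit \<open>A\<close> is positive.\<close>

lemma has_sum_Re_fourier_zero:
  assumes "fourier d f (\<lambda>_. 0) \<noteq> 0"
  shows "(f has_sum Re (fourier d f (\<lambda>_. 0))) (Zd d)"
proof -
  have fourier_eq: "fourier d f (\<lambda>_. 0) = (\<Sum>\<^sub>\<infinity>x\<in>Zd d. complex_of_real (f x))"
    by (simp add: fourier_def)
  have "(\<lambda>x. complex_of_real (f x)) summable_on Zd d"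
    using assms infsum_not_exists unfolding fourier_eq by blast
  then have "((\<lambda>x. complex_of_real (f x)) has_sum fourier d f (\<lambda>_. 0)) (Zd d)"
    unfolding fourier_eq by (rule has_sum_infsum)
  \<comment> \<open>The terms are real numbers embedded in the complex plane, so taking real parts
    recovers the real series.\<close>
  from has_sum_Re[OF this] show ?thesis
    by simp
qed

text \<open>The singleton of the origin is compact, and uniform convergence on it is convergence at
  one point.\<close>

lemma tau_scaling_limit_at_zero:
  assumes "tau_scaling_limit d \<alpha> v D A K"
  shows "(\<lambda>n. fourier d (two_point d D (p_crit d D) n) (\<lambda>_. 0)) \<longlonglongrightarrow> complex_of_real A"
proof -
  have "compactin (Euclidean_space d) {\<lambda>_. 0}"
    by (simp add: topspace_Euclidean_space)
  then have "uniform_limit {\<lambda>_. 0}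
      (\<lambda>n k. fourier d (two_point d D (p_crit d D) n) (\<lambda>i. scale \<alpha> v n * k i))
      (\<lambda>k. complex_of_real (A * exp (- K * enorm d k powr two_min \<alpha>))) sequentially"
    using assms unfolding tau_scaling_limit_def by blast
  \<comment> \<open>Rescaling fixes the origin, and \<open>0 powr a = 0\<close> for every
    \<open>a\<close>, so the limit is \<open>A * exp 0\<close> for all \<alpha>.\<close>
  from tendsto_uniform_limitI[OF this, of "\<lambda>_. 0"] show ?thesis
    by (simp add: L2_set_def)
qed

lemma tau_sum_asymptotics_if_scaling_limit:
  assumes "A > 0" and "tau_scaling_limit d \<alpha> v D A K"
  shows "tau_sum_asymptotics d D A"
proof -
  define F where "F n = fourier d (two_point d D (p_crit d D) n) (\<lambda>_. 0)" for n
  \<comment> \<open>Obtained by solving \<open>A * (1 + e n) = Re (F n)\<close> for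
    \<open>e n\<close>.\<close>
  define e where "e n = Re (F n) / A - 1" for n
  have lim: "F \<longlonglongrightarrow> complex_of_real A"
    unfolding F_def by (rule tau_scaling_limit_at_zero[OF assms(2)])
  have "e \<longlonglongrightarrow> Re (complex_of_real A) / A - 1"
    unfolding e_def using assms(1) by (intro tendsto_intros lim) auto
  then have "e \<in> o(\<lambda>_. 1)"
    using assms(1) by (intro smalloI_tendsto) auto
  \<comment> \<open>The limit \<open>A\<close> is nonzero; this supplies the premise of
    \<open>has_sum_Re_fourier_zero\<close> for large \<open>n\<close>.\<close>
  moreover have "\<forall>\<^sub>F n in sequentially. F n \<noteq> 0"
    using lim assms(1) by (intro tendsto_imp_eventually_ne) auto
  then have "\<forall>\<^sub>F n in sequentially.
      (two_point d D (p_crit d D) n has_sum (A * (1 + e n))) (Zd d)"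
  proof eventually_elim
    case (elim n)
    have "A * (1 + e n) = Re (F n)"
      using assms(1) by (simp add: e_def)
    with elim show ?case
      unfolding F_def by (simp add: has_sum_Re_fourier_zero)
  qed
  ultimately show ?thesis
    unfolding tau_sum_asymptotics_def by blast
qed

theorem corollary1p6:
  shows
    "(\<exists>d0::nat. \<forall>d\<ge>d0. \<forall>v A K :: real.
        assumption_C d \<infinity> v (nn_kernel d) \<longrightarrow>
        A > 0 \<longrightarrow> K > 0 \<longrightarrow>
        tau_scaling_limit d \<infinity> v (nn_kernel d) A K \<longrightarrow>
        tau_sum_asymptotics d (nn_kernel d) A)
     \<and>
     (\<forall>(d::nat) (\<alpha>::ereal) (h :: (nat \<Rightarrow> real) \<Rightarrow> real) (c1::real) (c2::real) (c3::real).
        real d > 3 * two_min \<alpha> \<longrightarrow> c1 > 0 \<longrightarrow> c2 > 0 \<longrightarrow> c3 > 0 \<longrightarrow>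
        (\<exists>L0::real. \<forall>L\<ge>L0. \<forall>D. \<forall>v A K :: real.
           step_kernel d D \<longrightarrow>
           assumption_A d \<alpha> h L D \<longrightarrow>
           assumption_B d \<alpha> c1 c2 c3 L D \<longrightarrow>
           assumption_C d \<alpha> v D \<longrightarrow>
           A > 0 \<longrightarrow> K > 0 \<longrightarrow>
           tau_scaling_limit d \<alpha> v D A K \<longrightarrow>
           tau_sum_asymptotics d D A))"
  \<comment> \<open>The nearest-neighbor half is the instance \<open>D = nn_kernel d\<close> with
    \<alpha> infinite; \<open>0\<close> serves as witness for \<open>d0\<close> and
    \<open>L0\<close>.\<close>
  using tau_sum_asymptotics_if_scaling_limit by blast

end
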